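(* Assume that each local function $f_i$ and all decompositions $f_i=f_i^{\alpha k}+f_i^{\beta k}$ satisfy Assumptions 1, 2 and 3 of the context, and that the matrix $U+D-A^TA$ is positive semi-definite. Then, for every initialization $\bm{x}^0\in\mathbb{R}^{2Nn}$, the iterates $\bm{x}^k$ generated by Algorithm I converge to the optimal solution $\bm{x}^*$ of the problem $\min_{\bm{x}\in\mathbb{R}^{2Nn}}\sum_{i=1}^{2N}h_i^k(\bm{x}_i)$ subject to $A\bm{x}=\bm{0}$, i.e. $\lim_{k\to\infty}\bm{x}^k=\bm{x}^*$.
   Context: Network. $G=(V,E)$ is a connected undirected graph on $N$ agents, and $f_i:\mathbb{R}^n\to\mathbb{R}$ is the local objective of agent $i$. For each $k=0,1,2,\dots$ each $f_i$ is decomposed as $f_i=f_i^{\alpha k}+f_i^{\beta k}$. The virtual network $G'=(V',E')$ has $2N$ nodes $\alpha_1,\beta_1,\dots,\alpha_N,\beta_N$: $\alpha_i$ and $\alpha_j$ are adjacent iff $i,j$ are adjacent in $G$, $\alpha_i$ and $\beta_i$ are adjacent for each $i$, and there are no other edges. Relabel the nodes as $1,\dots,2N$ ($\alpha_i\mapsto 2i-1$, $\beta_i\mapsto 2i$) and correspondingly the functions $f_i^{\alpha k},f_i^{\beta k}$ as $h_1^k,\dots,h_{2N}^k$. Let $\mathcal{N}_i$ be the set of neighbors of $i$ in $G'$ and $D_i=|\mathcal{N}_i|$. Each edge $e_{i,j}\in E'$, $i<j$, originates from $i$ and terminates at $j$. Matrices. $A=[a_{m,l}]\otimes I_n\in\mathbb{R}^{|E'|n\times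 2Nn}$ is the edge-node incidence matrix: $a_{m,l}=1$ if the $m$-th edge originates from $l$, $-1$ if it terminates at $l$, $0$ otherwise. $U=\mathrm{diag}\{\gamma_1,\dots,\gamma_{2N}\}\otimes I_n$ with constants $\gamma_i>0$; $D=\mathrm{diag}\{D_1,\dots,D_{2N}\}\otimes I_n$. $\rho>0$ is a constant. Algorithm I. Initialize $\bm{x}_i^0\in\mathbb{R}^n$ arbitrarily and set $\bm{\lambda}_{i,j}^0=\bm{x}_i^0-\bm{x}_j^0$ for all $i$ and $j\in\mathcal{N}_i$. For $k=0,1,2,\dots$ and all $i=1,\dots,2N$: $$\bm{x}_i^{k+1}=\operatorname*{argmin}_{\bm{x}_i}\ h_i^{k+1}(\bm{x}_i)+\tfrac{\gamma_i\rho}{2}\|\bm{x}_i-\bm{x}_i^k\|^2+\sum_{j\in\mathcal{N}_i}\Big((\bm{\lambda}_{i,j}^k)^T(\bm{x}_i-\bm{x}_j^k)+\tfrac{\rho}{2}\|\bm{x}_i-\bm{x}_j^k\|^2\Big),$$ $$\bm{\lambda}_{i,j}^{k+1}=\bm{\lambda}_{i,j}^k+\rho(\bm{x}_i^{k+1}-\bm{x}_j^{k+1}),\quad j\in\mathcal{N}_i.$$ Write $\bm{x}^k=[\bm{x}_1^{kT},\dots,\bm{x}_{2N}^{kT}]^T$. The optimal solution $\bm{x}^*$ of $\min\sum_{i=1}^{2N}h_i^k(\bm{x}_i)$ s.t. $A\bm{x}=\bm{0}$ does not depend on $k$: since $G'$ is connected, $A\bm{x}=\bm{0}$ means all blocks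 $\bm{x}_i$ are equal, and the objective there is $\sum_{i=1}^N f_i$. Assumption 1. Each $f_i$ is continuously differentiable and $(\nabla f_i(\bm{x})-\nabla f_i(\bm{y}))^T(\bm{x}-\bm{y})\ge m_i\|\bm{x}-\bm{y}\|^2$ for all $\bm{x},\bm{y}$; there is $m_f>0$ with $m_i\ge 2m_f$ for all $i$. Assumption 2. Each $f_i$ has $L_i$-Lipschitz continuous gradient. Assumption 3. For all $i,k$: $f_i^{\alpha k}$ and $f_i^{\beta k}=f_i-f_i^{\alpha k}$ are differentiable and strongly convex with modulus $m_f$ (the inequality of Assumption 1 with $m_f$ in place of $m_i$); both have $L$-Lipschitz continuous gradients, for a constant $L<+\infty$ independent of $i,k$; $f_i^{\alpha k}$ converges (pointwise) to a function $f_i^{\alpha *}$ as $k\to\infty$; and $f_i^{\alpha k}(\bm{x})$ is bounded when $\bm{x}$ is bounded. *)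

theory Defs
  imports "HOL-Analysis.Analysis"
begin

definition grad :: "('a::euclidean_space \<Rightarrow> real) \<Rightarrow> 'a \<Rightarrow> 'a" where
  "grad g x = (THE D. GDERIV g x :> D)"

definition strong_monotone_grad :: "real \<Rightarrow> ('a::euclidean_space \<Rightarrow> real) \<Rightarrow> bool" where
  "strong_monotone_grad m g \<longleftrightarrow>
     (\<forall>x y. m * (norm (x - y))\<^sup>2 \<le> (grad g x - grad g y) \<bullet> (x - y))"

definition assumption1 ::
  "('v \<Rightarrow> real) \<Rightarrow> real \<Rightarrow> ('v \<Rightarrow> 'a::euclidean_space \<Rightarrow> real) \<Rightarrow> bool" where
  "assumption1 m mf f \<longleftrightarrow>
     (\<forall>i. f i differentiable_on UNIV \<and> continuous_on UNIV (grad (f i)) \<and>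
          strong_monotone_grad (m i) (f i)) \<and>
     0 < mf \<and> (\<forall>i. 2 * mf \<le> m i)"

definition assumption2 ::
  "('v \<Rightarrow> real) \<Rightarrow> ('v \<Rightarrow> 'a::euclidean_space \<Rightarrow> real) \<Rightarrow> bool" where
  "assumption2 Lf f \<longleftrightarrow> (\<forall>i. (Lf i)-lipschitz_on UNIV (grad (f i)))"

text \<open>The last conjunct asks for a bound on each bounded set that is uniform in \<open>k\<close>.\<close>

definition assumption3 ::
  "real \<Rightarrow> real \<Rightarrow> (nat \<Rightarrow> 'v \<Rightarrow> 'a::euclidean_space \<Rightarrow> real)
     \<Rightarrow> (nat \<Rightarrow> 'v \<Rightarrow> 'a \<Rightarrow> real) \<Rightarrow> ('v \<Rightarrow> 'a \<Rightarrow> real) \<Rightarrow> bool" where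
  "assumption3 mf L f\<alpha> f\<beta> f\<alpha>_lim \<longleftrightarrow>
     (\<forall>i k. f\<alpha> k i differentiable_on UNIV \<and> f\<beta> k i differentiable_on UNIV \<and>
            strong_monotone_grad mf (f\<alpha> k i) \<and> strong_monotone_grad mf (f\<beta> k i) \<and>
            L-lipschitz_on UNIV (grad (f\<alpha> k i)) \<and> L-lipschitz_on UNIV (grad (f\<beta> k i))) \<and>
     (\<forall>i x. (\<lambda>k. f\<alpha> k i x) \<longlonglongrightarrow> f\<alpha>_lim i x) \<and>
     (\<forall>i S. bounded S \<longrightarrow> bounded (\<Union>k. f\<alpha> k i ` S))"

text \<open>
  A simple undirected graph on the type \<open>'v\<close> is given by its symmetric irreflexive
  adjacency relation.
\<close>

definition connected_graph :: "('v \<times> 'v) set \<Rightarrow> bool" where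
  "connected_graph E \<longleftrightarrow> sym E \<and> irrefl E \<and> E\<^sup>* = UNIV"

text \<open>
  The virtual network: \<open>Inl i\<close> is the node \<open>\<alpha>\<^sub>i\<close>, \<open>Inr i\<close> is the node \<open>\<beta>\<^sub>i\<close>.
\<close>

definition virtual_graph :: "('v \<times> 'v) set \<Rightarrow> (('v + 'v) \<times> ('v + 'v)) set" where
  "virtual_graph E =
     {(Inl i, Inl j) | i j. (i, j) \<in> E} \<union> {(Inl i, Inr i) | i. True} \<union> {(Inr i, Inl i) | i. True}"

text \<open>The relabelling of the virtual nodes, for agents numbered from 1 by \<open>num\<close>.\<close>

fun node_label :: "('v \<Rightarrow> nat) \<Rightarrow> 'v + 'v \<Rightarrow> nat" where
  "node_label num (Inl i) = 2 * num i - 1"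
| "node_label num (Inr i) = 2 * num i"

definition node_objective ::
  "(nat \<Rightarrow> 'v \<Rightarrow> 'a \<Rightarrow> real) \<Rightarrow> (nat \<Rightarrow> 'v \<Rightarrow> 'a \<Rightarrow> real) \<Rightarrow> nat \<Rightarrow> 'v + 'v \<Rightarrow> 'a \<Rightarrow> real" where
  "node_objective f\<alpha> f\<beta> k = case_sum (f\<alpha> k) (f\<beta> k)"

definition neighbors :: "('w \<times> 'w) set \<Rightarrow> 'w \<Rightarrow> 'w set" where
  "neighbors E i = {j. (i, j) \<in> E}"

text \<open>Each undirected edge, represented once, as the pair (origin, terminus).\<close>

definition oriented_edges :: "('w \<Rightarrow> nat) \<Rightarrow> ('w \<times> 'w) set \<Rightarrow> ('w \<times> 'w) set" where
  "oriented_edges lab E = {(i, j) \<in> E. lab i < lab j}"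

text \<open>
  Here \<open>edge\<close> enumerates the oriented edges by an index type \<open>'e\<close>, so that the rows of the
  incidence matrix are indexed by edges and \<open>CARD('e)\<close> is the number of edges.
\<close>

definition kronecker ::
  "real ^ 'b::finite ^ 'a::finite \<Rightarrow> real ^ 'd::finite ^ 'c::finite \<Rightarrow> real ^ ('b \<times> 'd) ^ ('a \<times> 'c)" where
  "kronecker M K = (\<chi> p q. M $ fst p $ fst q * K $ snd p $ snd q)"

definition diag :: "('w::finite \<Rightarrow> real) \<Rightarrow> real ^ 'w ^ 'w" where
  "diag d = (\<chi> i j. if i = j then d i else 0)"

definition incidence :: "('e::finite \<Rightarrow> 'w::finite \<times> 'w) \<Rightarrow> real ^ 'w ^ 'e" where
  "incidence edge =
     (\<chi> m l. if fst (edge m) = l then 1 else if snd (edge m) = l then - 1 else 0)"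

definition A_matrix ::
  "('e::finite \<Rightarrow> 'w::finite \<times> 'w) \<Rightarrow> real ^ ('w \<times> 'n::finite) ^ ('e \<times> 'n)" where
  "A_matrix edge = kronecker (incidence edge) (mat 1)"

definition U_matrix :: "('w::finite \<Rightarrow> real) \<Rightarrow> real ^ ('w \<times> 'n::finite) ^ ('w \<times> 'n)" where
  "U_matrix \<gamma> = kronecker (diag \<gamma>) (mat 1)"

definition D_matrix :: "('w::finite \<times> 'w) set \<Rightarrow> real ^ ('w \<times> 'n::finite) ^ ('w \<times> 'n)" where
  "D_matrix E = kronecker (diag (\<lambda>i. real (card (neighbors E i)))) (mat 1)"

definition pos_semidef :: "real ^ 'm::finite ^ 'm \<Rightarrow> bool" where
  "pos_semidef M \<longleftrightarrow> transpose M = M \<and> (\<forall>x. 0 \<le> x \<bullet> (M *v x))"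

text \<open>
  A stacked vector, indexed by node and coordinate, and its blocks in \<open>real ^ 'n\<close>
\<close>

definition block :: "real ^ ('w::finite \<times> 'n::finite) \<Rightarrow> 'w \<Rightarrow> real ^ 'n" where
  "block x i = (\<chi> c. x $ (i, c))"

definition stack :: "('w::finite \<Rightarrow> real ^ 'n::finite) \<Rightarrow> real ^ ('w \<times> 'n)" where
  "stack b = (\<chi> p. b (fst p) $ snd p)"

text \<open>The function minimized by node \<open>i\<close>, where \<open>g\<close> stands for \<open>h\<^sub>i\<^sup>k\<^sup>+\<^sup>1\<close>.\<close>

definition local_objective ::
  "('w \<times> 'w) set \<Rightarrow> ('w \<Rightarrow> real) \<Rightarrow> real \<Rightarrow> (real ^ 'n \<Rightarrow> real)
     \<Rightarrow> real ^ ('w::finite \<times> 'n::finite) \<Rightarrow> ('w \<Rightarrow> 'w \<Rightarrow> real ^ 'n) \<Rightarrow> 'w \<Rightarrow> real ^ 'n \<Rightarrow> real" where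
  "local_objective E \<gamma> \<rho> g x \<Lambda> i y =
     g y + \<gamma> i * \<rho> / 2 * (norm (y - block x i))\<^sup>2 +
     (\<Sum>j\<in>neighbors E i. \<Lambda> i j \<bullet> (y - block x j) + \<rho> / 2 * (norm (y - block x j))\<^sup>2)"

text \<open>
  The pair of the stacked iterate and the multipliers. The multipliers are defined
  for all pairs of nodes; only those of neighbors enter the iteration.
\<close>

primrec algorithm1 ::
  "('w \<times> 'w) set \<Rightarrow> ('w \<Rightarrow> real) \<Rightarrow> real \<Rightarrow> (nat \<Rightarrow> 'w \<Rightarrow> real ^ 'n \<Rightarrow> real)
     \<Rightarrow> real ^ ('w::finite \<times> 'n::finite) \<Rightarrow> nat
     \<Rightarrow> (real ^ ('w \<times> 'n)) \<times> ('w \<Rightarrow> 'w \<Rightarrow> real ^ 'n)" where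
  "algorithm1 E \<gamma> \<rho> h x0 0 = (x0, \<lambda>i j. block x0 i - block x0 j)"
| "algorithm1 E \<gamma> \<rho> h x0 (Suc k) =
     (let (x, \<Lambda>) = algorithm1 E \<gamma> \<rho> h x0 k;
          x' = stack (\<lambda>i. arg_min (local_objective E \<gamma> \<rho> (h (Suc k) i) x \<Lambda> i) (\<lambda>_. True))
      in (x', \<lambda>i j. \<Lambda> i j + \<rho> *\<^sub>R (block x' i - block x' j)))"

definition iterate ::
  "('w \<times> 'w) set \<Rightarrow> ('w \<Rightarrow> real) \<Rightarrow> real \<Rightarrow> (nat \<Rightarrow> 'w \<Rightarrow> real ^ 'n \<Rightarrow> real)
     \<Rightarrow> real ^ ('w::finite \<times> 'n::finite) \<Rightarrow> nat \<Rightarrow> real ^ ('w \<times> 'n)" where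
  "iterate E \<gamma> \<rho> h x0 k = fst (algorithm1 E \<gamma> \<rho> h x0 k)"

definition optimal_solution ::
  "('e::finite \<Rightarrow> 'w \<times> 'w) \<Rightarrow> ('w \<Rightarrow> real ^ 'n \<Rightarrow> real)
     \<Rightarrow> real ^ ('w::finite \<times> 'n::finite) \<Rightarrow> bool" where
  "optimal_solution edge g x \<longleftrightarrow>
     is_arg_min (\<lambda>z. \<Sum>i\<in>UNIV. g i (block z i)) (\<lambda>z. A_matrix edge *v z = 0) x"

end

theory Submission
  imports Defs
begin

text \<open>
  Put \<open>Q = A\<^sup>T A\<close>, \<open>P = U + D - Q\<close> and \<open>s\<^sup>k = x\<^sup>0 + \<rho> (x\<^sup>1 + \<dots> + x\<^sup>k)\<close>. The multipliers are
  the differences of the blocks of \<open>s\<^sup>k\<close>, so the optimality conditions of the local minimizations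
  combine to \<open>\<nabla>h\<^sup>k\<^sup>+\<^sup>1(x\<^sup>k\<^sup>+\<^sup>1) + \<rho> P (x\<^sup>k\<^sup>+\<^sup>1 - x\<^sup>k) + Q s\<^sup>k\<^sup>+\<^sup>1 = 0\<close>.
  At the optimum \<open>x\<^sup>*\<close> the gradients \<open>\<nabla>h\<^sup>k(x\<^sup>*)\<close> converge, because the \<open>h\<^sup>k\<close> converge pointwise and have
  uniformly Lipschitz gradients. Their limit is orthogonal to the kernel of \<open>Q\<close> and hence equals
  \<open>- Q s\<^sup>*\<close> for some \<open>s\<^sup>*\<close>. The Lyapunov function
  \<open>V\<^sup>k = \<rho>/2 |x\<^sup>k - x\<^sup>*|\<^sup>2\<^sub>P + 1/(2\<rho>) |s\<^sup>k - s\<^sup>*|\<^sup>2\<^sub>Q\<close> contracts by a fixed factor up to an error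
  proportional to \<open>|\<nabla>h\<^sup>k\<^sup>+\<^sup>1(x\<^sup>*) + Q s\<^sup>*|\<^sup>2\<close>. This error need not be summable, but it tends to 0,
  which suffices since the contraction is geometric.
\<close>

section \<open>Scalar recursions with a vanishing perturbation\<close>

lemma perturbed_contraction_tendsto_0:
  fixes a b :: "nat \<Rightarrow> real"
  assumes a: "\<And>k. 0 \<le> a k" and q: "0 \<le> q" "q < 1"
    and step: "\<And>k. a (Suc k) \<le> q * a k + b k" and b: "b \<longlonglongrightarrow> 0"
  shows "a \<longlonglongrightarrow> 0"
proof (rule LIMSEQ_I)
  fix e :: real assume e: "0 < e"
  \<comment> \<open>Once \<open>b\<close> stays below this threshold, \<open>e / 2\<close> is a
    fixed point of the dominating affine map, so the accumulated errors never exceed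
    \<open>e / 2\<close>.\<close>
  then have "0 < e / 2 * (1 - q)" using q by simp
  then obtain K where K: "\<And>k. k \<ge> K \<Longrightarrow> norm (b k - 0) < e / 2 * (1 - q)"
    using LIMSEQ_D[OF b] by blast
  have bound: "a (K + n) \<le> q ^ n * a K + e / 2" for n
  proof (induction n)
    case (Suc n)
    have "a (K + Suc n) \<le> q * a (K + n) + e / 2 * (1 - q)"
      using step[of "K + n"] K[of "K + n"] by auto
    also have "\<dots> \<le> q * (q ^ n * a K + e / 2) + e / 2 * (1 - q)"
      using mult_left_mono[OF Suc q(1)] by simp
    finally show ?case by (simp add: algebra_simps diff_divide_distrib)
  qed (use e in simp)
  have "(\<lambda>n. q ^ n * a K) \<longlonglongrightarrow> 0"
    using q by (intro tendsto_mult_left_zero LIMSEQ_realpow_zero)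
  then obtain M where M: "\<And>n. n \<ge> M \<Longrightarrow> norm (q ^ n * a K - 0) < e / 2"
    using LIMSEQ_D[of _ 0 "e / 2"] e by (metis half_gt_zero)
  have "norm (a n - 0) < e" if "n \<ge> K + M" for n
  proof -
    have "M \<le> n - K" "K + (n - K) = n" using that by auto
    then show ?thesis using bound[of "n - K"] M[of "n - K"] a[of n] by simp
  qed
  then show "\<exists>no. \<forall>n\<ge>no. norm (a n - 0) < e" by blast
qed

subsection \<open>Self-adjoint operators\<close>

text \<open>The orthogonal complement of the range is the kernel: for \<open>z\<close> orthogonal to
  the range, \<open>Q z \<bullet> Q z = z \<bullet> Q (Q z) = 0\<close>.\<close>

lemma self_adjoint_decomposition:
  fixes Q :: "'a::euclidean_space \<Rightarrow> 'a"
  assumes lin: "linear Q" and sym: "\<And>x y. x \<bullet> Q y = Q x \<bullet> y"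
  obtains u z where "x = Q u + z" "Q z = 0" "z \<bullet> Q u = 0"
proof -
  have sp: "span (range Q) = range Q"
    by (simp add: lin linear_subspace_image span_eq_iff)
  obtain y z where yz: "y \<in> range Q" "\<And>w. w \<in> range Q \<Longrightarrow> orthogonal z w" "x = y + z"
    using orthogonal_subspace_decomp_exists[of "range Q" x] unfolding sp by metis
  have "Q z \<bullet> Q z = z \<bullet> Q (Q z)" by (simp add: sym)
  also have "\<dots> = 0" using yz(2)[of "Q (Q z)"] by (simp add: orthogonal_def)
  finally have "Q z = 0" by simp
  with yz that show ?thesis by (auto simp: orthogonal_def)
qed

text \<open>The kernel component of \<open>g\<close> is orthogonal to \<open>g\<close> and to the
  range, hence to itself. This produces the dual optimum for the limit gradient.\<close>

lemma range_self_adjoint: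
  fixes Q :: "'a::euclidean_space \<Rightarrow> 'a"
  assumes lin: "linear Q" and sym: "\<And>x y. x \<bullet> Q y = Q x \<bullet> y"
    and orth: "\<And>z. Q z = 0 \<Longrightarrow> g \<bullet> z = 0"
  shows "g \<in> range Q"
proof -
  obtain u z where *: "g = Q u + z" "Q z = 0" "z \<bullet> Q u = 0"
    using self_adjoint_decomposition[OF lin sym] by metis
  then have "z \<bullet> z = 0"
    using orth[of z] by (simp add: inner_add_right inner_commute)
  then have "z = 0" by simp
  with * show ?thesis by auto
qed

text \<open>\<open>Q\<close> is injective on its range, hence bounded below there by some
  \<open>e\<close>; the kernel component of \<open>w\<close> drops out of both sides.\<close>

lemma self_adjoint_quadratic_form_bound:
  fixes Q :: "'a::euclidean_space \<Rightarrow> 'a"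
  assumes lin: "linear Q" and sym: "\<And>x y. x \<bullet> Q y = Q x \<bullet> y"
  obtains C where "0 < C" "\<And>w. w \<bullet> Q w \<le> C * (norm (Q w))\<^sup>2"
proof -
  have inj: "x = 0" if x: "x \<in> range Q" "Q x = 0" for x
  proof -
    obtain u where u: "x = Q u" using x by auto
    have "x \<bullet> x = u \<bullet> Q x" using u by (simp add: sym)
    with x show ?thesis by simp
  qed
  have sub: "subspace (range Q)" by (simp add: lin linear_subspace_image)
  obtain e where e: "e > 0" "\<And>x. x \<in> range Q \<Longrightarrow> e * norm x \<le> norm (Q x)"
    using injective_imp_isometric[OF closed_subspace[OF sub] sub] inj lin
    by (metis linear_conv_bounded_linear)
  have "w \<bullet> Q w \<le> 1 / e * (norm (Q w))\<^sup>2" for w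
  proof -
    obtain u z where *: "w = Q u + z" "Q z = 0" "z \<bullet> Q u = 0"
      using self_adjoint_decomposition[OF lin sym] by metis
    have Qw: "Q w = Q (Q u)" using * lin by (simp add: linear_add)
    have "w \<bullet> Q w = Q u \<bullet> Q w"
      using * Qw sym[of z "Q u"] by (simp add: inner_add_left)
    also have "\<dots> \<le> norm (Q u) * norm (Q w)" by (rule norm_cauchy_schwarz)
    also have "\<dots> \<le> norm (Q w) / e * norm (Q w)"
      using e(2)[of "Q u"] e(1) Qw by (intro mult_right_mono) (auto simp: field_simps)
    finally show ?thesis by (simp add: power2_eq_square)
  qed
  with e(1) that show ?thesis by (metis zero_less_divide_1_iff)
qed

text \<open>The bound on \<open>norm (P w)\<close> comes from nonnegativity of the form at
  \<open>w - t *\<^sub>R P w\<close>: for \<open>t = 1 / K\<close> the linear term outweighs the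
  quadratic one by at least \<open>(norm (P w))\<^sup>2 / K\<close>.\<close>

lemma pos_semidef_norm_bound:
  fixes P :: "'a::euclidean_space \<Rightarrow> 'a"
  assumes lin: "linear P" and sym: "\<And>x y. x \<bullet> P y = P x \<bullet> y" and psd: "\<And>x. 0 \<le> x \<bullet> P x"
  obtains K where "0 < K" "\<And>w. (norm (P w))\<^sup>2 \<le> K * (w \<bullet> P w)" "\<And>w. w \<bullet> P w \<le> K * (norm w)\<^sup>2"
proof -
  obtain K where K: "0 < K" "\<And>x. norm (P x) \<le> norm x * K"
    using bounded_linear.pos_bounded lin by (metis linear_conv_bounded_linear)
  have quad: "w \<bullet> P w \<le> K * (norm w)\<^sup>2" for w
  proof -
    have "w \<bullet> P w \<le> norm w * norm (P w)" by (rule norm_cauchy_schwarz)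
    also have "\<dots> \<le> norm w * (norm w * K)" using K by (intro mult_left_mono) auto
    finally show ?thesis by (simp add: power2_eq_square mult_ac)
  qed
  have "(norm (P w))\<^sup>2 \<le> K * (w \<bullet> P w)" for w
  proof -
    have expand: "(w - t *\<^sub>R P w) \<bullet> P (w - t *\<^sub>R P w)
        = w \<bullet> P w - 2 * t * (P w \<bullet> P w) + t\<^sup>2 * (P w \<bullet> P (P w))" for t
      using lin sym[of w "P w"]
      by (simp add: linear_diff linear_scale inner_diff algebra_simps power2_eq_square)
    have "0 \<le> w \<bullet> P w - 2 * (1/K) * (P w \<bullet> P w) + (1/K)\<^sup>2 * (P w \<bullet> P (P w))"
      using psd[of "w - (1/K) *\<^sub>R P w"] unfolding expand .
    also have "\<dots> \<le> w \<bullet> P w - 2 * (1/K) * (P w \<bullet> P w) + (1/K)\<^sup>2 * (K * (norm (P w))\<^sup>2)"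
      using quad[of "P w"] by (intro add_left_mono mult_left_mono) auto
    also have "\<dots> = w \<bullet> P w - (norm (P w))\<^sup>2 / K"
      using K(1) by (simp add: power2_norm_eq_inner power_divide power2_eq_square[of K] field_simps)
    finally show ?thesis using K(1) by (simp add: field_simps)
  qed
  with K(1) quad that show ?thesis by blast
qed

section \<open>Lyapunov analysis of the abstract primal-dual iteration\<close>

lemma self_adjoint_inner_diff:
  fixes P :: "'a::real_inner \<Rightarrow> 'a"
  assumes lin: "linear P" and sym: "\<And>x y. x \<bullet> P y = P x \<bullet> y"
  shows "P (a - b) \<bullet> a = (a \<bullet> P a - b \<bullet> P b + (a - b) \<bullet> P (a - b)) / 2"
  using sym[of a b] sym[of b a] sym[of a a] sym[of b b]
  by (simp add: linear_diff[OF lin] inner_diff inner_commute)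

lemma norm_sum3_squared_le:
  fixes a b c :: "'a::real_inner"
  shows "(norm (a + b + c))\<^sup>2 \<le> 3 * ((norm a)\<^sup>2 + (norm b)\<^sup>2 + (norm c)\<^sup>2)"
proof -
  have "0 \<le> (norm (a - b))\<^sup>2 + (norm (b - c))\<^sup>2 + (norm (a - c))\<^sup>2" by simp
  then show ?thesis
    unfolding power2_norm_eq_inner by (simp add: inner_diff inner_add inner_commute)
qed

text \<open>Algorithm I enters only through the multiplier sum \<open>s\<close> and the stationarity
  condition \<open>opt\<close>. The kernel of \<open>Q\<close> stands for the consensus space, so
  the second part of \<open>xs\<close> says that the stacked gradient at the optimum vanishes along
  feasible directions.\<close>

theorem primal_dual_convergence:
  fixes P Q :: "'a::euclidean_space \<Rightarrow> 'a" and G :: "nat \<Rightarrow> 'a \<Rightarrow> 'a" and x s :: "nat \<Rightarrow> 'a"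
  assumes P: "linear P" "\<And>x y. x \<bullet> P y = P x \<bullet> y" "\<And>x. 0 \<le> x \<bullet> P x"
    and Q: "linear Q" "\<And>x y. x \<bullet> Q y = Q x \<bullet> y" "\<And>x. 0 \<le> x \<bullet> Q x"
    and \<mu>: "0 < \<mu>" and \<rho>: "0 < \<rho>"
    and mono: "\<And>k y z. \<mu> * (norm (y - z))\<^sup>2 \<le> (G k y - G k z) \<bullet> (y - z)"
    and lip: "\<And>k y z. norm (G k y - G k z) \<le> L * norm (y - z)"
    and xs: "Q xs = 0" "\<And>k z. Q z = 0 \<Longrightarrow> G k xs \<bullet> z = 0" "convergent (\<lambda>k. G k xs)"
    and s: "\<And>k. s (Suc k) = s k + \<rho> *\<^sub>R x (Suc k)"
    and opt: "\<And>k. G (Suc k) (x (Suc k)) + \<rho> *\<^sub>R P (x (Suc k) - x k) + Q (s (Suc k)) = 0"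
  shows "x \<longlonglongrightarrow> xs"
proof -
  obtain g where g: "(\<lambda>k. G k xs) \<longlonglongrightarrow> g" using xs(3) by (auto simp: convergent_def)
  have "g \<bullet> z = 0" if "Q z = 0" for z
  proof -
    have "(\<lambda>k. G k xs \<bullet> z) \<longlonglongrightarrow> g \<bullet> z" by (intro tendsto_intros g)
    then show ?thesis using that xs(2) by (simp add: LIMSEQ_const_iff)
  qed
  then obtain u where u: "g = Q u" using range_self_adjoint[OF Q(1,2)] by blast
  \<comment> \<open>The sign makes \<open>ss\<close> a limiting multiplier:
    \<open>g + Q ss = 0\<close> is the limiting optimality condition at \<open>xs\<close>.\<close>
  define ss where "ss = - u"
  have ss: "Q ss = - g" by (simp add: ss_def u linear_neg[OF Q(1)])
  obtain K where K: "0 < K" "\<And>w. (norm (P w))\<^sup>2 \<le> K * (w \<bullet> P w)" "\<And>w. w \<bullet> P w \<le> K * (norm w)\<^sup>2"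
    using pos_semidef_norm_bound[OF P] by metis
  obtain C where C: "0 < C" "\<And>w. w \<bullet> Q w \<le> C * (norm (Q w))\<^sup>2"
    using self_adjoint_quadratic_form_bound[OF Q(1,2)] by metis
  define V where "V k = \<rho> / 2 * ((x k - xs) \<bullet> P (x k - xs))
      + 1 / (2 * \<rho>) * ((s k - ss) \<bullet> Q (s k - ss))" for k
  \<comment> \<open>\<open>r\<close> is the drift of the gradient at the optimum and
    \<open>R\<close> its cost in Young's inequality, which spends half of the modulus
    \<open>\<mu>\<close>; the other half stays in \<open>D\<close>.\<close>
  define r where "r k = G (Suc k) xs - g" for k
  define R where "R k = (norm (r k))\<^sup>2 / (2 * \<mu>)" for k
  define p where "p k = (x (Suc k) - x k) \<bullet> P (x (Suc k) - x k)" for k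
  define D where "D k = \<mu> / 2 * (norm (x (Suc k) - xs))\<^sup>2 + \<rho> / 2 * p k" for k
  have r: "r \<longlonglongrightarrow> 0"
    unfolding r_def using LIM_zero[OF LIMSEQ_Suc[OF g]] .
  have "R \<longlonglongrightarrow> (norm (0::'a))\<^sup>2 / (2 * \<mu>)"
    unfolding R_def using \<mu> by (intro tendsto_intros r) auto
  then have R: "R \<longlonglongrightarrow> 0" by simp
  have V0: "0 \<le> V k" for k
    unfolding V_def using \<rho> P(3) Q(3) by (intro add_nonneg_nonneg mult_nonneg_nonneg) auto
  have R0: "0 \<le> R k" and p0: "0 \<le> p k" for k
    unfolding R_def p_def using \<mu> P(3) by auto
  have D0: "0 \<le> D k" for k unfolding D_def using \<mu> \<rho> p0 by simp
  \<comment> \<open>The limiting condition is subtracted from \<open>opt\<close>, with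
    \<open>G (Suc k) xs\<close> inserted so that monotonicity applies to the first
    difference.\<close>
  have kkt: "(G (Suc k) (x (Suc k)) - G (Suc k) xs) + r k + \<rho> *\<^sub>R P (x (Suc k) - x k)
      + Q (s (Suc k) - ss) = 0" for k
    using opt[of k] by (simp add: r_def linear_diff[OF Q(1)] ss)
  have descent: "V (Suc k) + D k \<le> V k + R k" for k
  proof -
    define e where "e = x (Suc k) - xs"
    define e' where "e' = x k - xs"
    define w where "w = s (Suc k) - ss"
    define w' where "w' = s k - ss"
    define \<delta> where "\<delta> = G (Suc k) (x (Suc k)) - G (Suc k) xs"
    have ww': "w - w' = \<rho> *\<^sub>R x (Suc k)" by (simp add: w_def w'_def s)
    \<comment> \<open>\<open>e\<close> and \<open>x (Suc k)\<close> differ by the kernel vector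
      \<open>xs\<close>, and \<open>\<rho> *\<^sub>R x (Suc k)\<close> is the increment of
      \<open>s\<close>; polarization then gives the telescoping dual part of
      \<open>V\<close>.\<close>
    have "Q w \<bullet> e = Q w \<bullet> x (Suc k)"
      using xs(1) Q(2)[of w xs] by (simp add: e_def inner_diff_right)
    also have "\<dots> = Q w \<bullet> (w - w') / \<rho>" using \<rho> by (simp add: ww')
    also have "\<dots> = Q (w - w') \<bullet> w / \<rho>" using Q(2)[of w "w - w'"] by (simp add: inner_commute)
    also have "\<dots> = (w \<bullet> Q w - w' \<bullet> Q w' + (w - w') \<bullet> Q (w - w')) / 2 / \<rho>"
      by (simp add: self_adjoint_inner_diff[OF Q(1,2)])
    also have "\<dots> \<ge> (w \<bullet> Q w - w' \<bullet> Q w') / 2 / \<rho>"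
      using \<rho> Q(3)[of "w - w'"] by (simp add: divide_right_mono)
    finally have dual: "(w \<bullet> Q w - w' \<bullet> Q w') / 2 / \<rho> \<le> Q w \<bullet> e" .
    have "x (Suc k) - x k = e - e'" by (simp add: e_def e'_def)
    then have primal: "P (x (Suc k) - x k) \<bullet> e = (e \<bullet> P e - e' \<bullet> P e' + p k) / 2"
      using self_adjoint_inner_diff[OF P(1,2), of e e'] by (simp add: p_def)
    have "(\<delta> + r k + \<rho> *\<^sub>R P (x (Suc k) - x k) + Q w) \<bullet> e = 0"
      using kkt[of k] by (simp add: \<delta>_def w_def)
    then have zero: "\<delta> \<bullet> e + r k \<bullet> e + \<rho> * (P (x (Suc k) - x k) \<bullet> e) + Q w \<bullet> e = 0"
      by (simp add: inner_add_left)
    have strong: "\<mu> * (norm e)\<^sup>2 \<le> \<delta> \<bullet> e" using mono by (simp add: \<delta>_def e_def)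
    have "0 \<le> (norm (r k + \<mu> *\<^sub>R e))\<^sup>2 / (2 * \<mu>)" using \<mu> by simp
    also have "(norm (r k + \<mu> *\<^sub>R e))\<^sup>2 = (norm (r k))\<^sup>2 + 2 * \<mu> * (r k \<bullet> e) + \<mu>\<^sup>2 * (norm e)\<^sup>2"
      unfolding power2_norm_eq_inner
      by (simp add: inner_add inner_commute power2_eq_square algebra_simps)
    finally have young: "- (r k \<bullet> e) \<le> R k + \<mu> / 2 * (norm e)\<^sup>2"
      using \<mu> by (simp add: R_def field_simps power2_eq_square)
    have Vk: "V k = \<rho> / 2 * (e' \<bullet> P e') + (w' \<bullet> Q w') / 2 / \<rho>"
      and Vk': "V (Suc k) = \<rho> / 2 * (e \<bullet> P e) + (w \<bullet> Q w) / 2 / \<rho>"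
      by (simp_all add: V_def e_def e'_def w_def w'_def)
    have "\<rho> / 2 * (e \<bullet> P e) - \<rho> / 2 * (e' \<bullet> P e') + \<rho> / 2 * p k
        = \<rho> * (P (x (Suc k) - x k) \<bullet> e)"
      unfolding primal by (simp add: algebra_simps add_divide_distrib diff_divide_distrib)
    then show ?thesis
      using zero strong young dual unfolding Vk Vk' D_def e_def[symmetric] diff_divide_distrib
      by linarith
  qed
  \<comment> \<open>The first summand bounds the primal part of \<open>V\<close>. The bracket
    collects the contributions to \<open>Q w\<close> of the gradient difference, the proximal term
    and \<open>r\<close>, in this order.\<close>
  define M where "M = K * \<rho> / \<mu> + 3 * C / \<rho> * (L\<^sup>2 / \<mu> + \<rho> * K + \<mu>)"
  have M: "0 < M" unfolding M_def using K(1) C(1) \<mu> \<rho> by (intro add_pos_pos mult_pos_pos add_nonneg_pos) auto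
  \<comment> \<open>Here \<open>kkt\<close> expresses \<open>Q w\<close> by three terms that
    \<open>D k\<close> and \<open>R k\<close> control, so these two dominate all of
    \<open>V (Suc k)\<close>.\<close>
  have bound: "V (Suc k) \<le> M * (D k + R k)" for k
  proof -
    define e where "e = x (Suc k) - xs"
    define w where "w = s (Suc k) - ss"
    define \<delta> where "\<delta> = G (Suc k) (x (Suc k)) - G (Suc k) xs"
    define d where "d = P (x (Suc k) - x k)"
    have e: "(norm e)\<^sup>2 \<le> 2 / \<mu> * (D k + R k)"
      using \<mu> \<rho> p0[of k] R0[of k] by (simp add: D_def e_def field_simps)
    have p: "p k \<le> 2 / \<rho> * (D k + R k)"
      using \<mu> \<rho> p0[of k] R0[of k] by (simp add: D_def e_def field_simps)
    have rr: "(norm (r k))\<^sup>2 \<le> 2 * \<mu> * (D k + R k)"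
      using \<mu> D0[of k] by (simp add: R_def field_simps)
    have "Q w = - (\<delta> + r k + \<rho> *\<^sub>R d)"
      unfolding \<delta>_def w_def d_def by (rule minus_unique[OF kkt[of k], symmetric])
    then have "(norm (Q w))\<^sup>2 \<le> 3 * ((norm \<delta>)\<^sup>2 + (norm (r k))\<^sup>2 + (norm (\<rho> *\<^sub>R d))\<^sup>2)"
      using norm_sum3_squared_le[of \<delta> "r k" "\<rho> *\<^sub>R d"] by (simp only: norm_minus_cancel)
    also have "(norm \<delta>)\<^sup>2 \<le> (L * norm e)\<^sup>2"
      using lip by (intro power_mono) (auto simp: \<delta>_def e_def)
    also have "(L * norm e)\<^sup>2 = L\<^sup>2 * (norm e)\<^sup>2" by (simp add: power_mult_distrib)
    also have "\<dots> \<le> L\<^sup>2 * (2 / \<mu> * (D k + R k))" using e by (intro mult_left_mono) auto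
    also have "(norm (\<rho> *\<^sub>R d))\<^sup>2 = \<rho>\<^sup>2 * (norm d)\<^sup>2" by (simp add: power_mult_distrib)
    also have "\<dots> \<le> \<rho>\<^sup>2 * (K * (2 / \<rho> * (D k + R k)))"
      using K(2)[of "x (Suc k) - x k"] p K(1) unfolding d_def p_def[symmetric]
      by (intro mult_left_mono order_trans[OF _ mult_left_mono[OF p]]) auto
    also have "\<dots> = 2 * (\<rho> * K) * (D k + R k)" using \<rho> by (simp add: power2_eq_square)
    also note rr
    finally have "(norm (Q w))\<^sup>2 \<le> 6 * (L\<^sup>2 / \<mu> + \<rho> * K + \<mu>) * (D k + R k)"
      by (simp add: algebra_simps)
    then have "w \<bullet> Q w \<le> C * (6 * (L\<^sup>2 / \<mu> + \<rho> * K + \<mu>) * (D k + R k))"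
      using C by (intro order_trans[OF C(2)] mult_left_mono) auto
    then have "1 / (2 * \<rho>) * (w \<bullet> Q w) \<le> 1 / (2 * \<rho>) * (C * (6 * (L\<^sup>2 / \<mu> + \<rho> * K + \<mu>) * (D k + R k)))"
      using \<rho> by (intro mult_left_mono) auto
    also have "\<dots> = 3 * C / \<rho> * (L\<^sup>2 / \<mu> + \<rho> * K + \<mu>) * (D k + R k)"
      using \<rho> by (simp add: field_simps)
    finally have dual: "1 / (2 * \<rho>) * (w \<bullet> Q w) \<le> \<dots>" .
    have "e \<bullet> P e \<le> K * (2 / \<mu> * (D k + R k))"
      using K e by (intro order_trans[OF K(3)] mult_left_mono) auto
    then have "\<rho> / 2 * (e \<bullet> P e) \<le> \<rho> / 2 * (K * (2 / \<mu> * (D k + R k)))"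
      using \<rho> by (intro mult_left_mono) auto
    also have "\<dots> = K * \<rho> / \<mu> * (D k + R k)" using \<mu> by (simp add: field_simps)
    finally have "\<rho> / 2 * (e \<bullet> P e) \<le> K * \<rho> / \<mu> * (D k + R k)" .
    with dual show ?thesis
      unfolding V_def M_def e_def[symmetric] w_def[symmetric] by (simp only: distrib_right)
  qed
  \<comment> \<open>Adding \<open>M\<close> times \<open>descent\<close> to \<open>bound\<close>
    cancels \<open>D k\<close>; the leftover \<open>2 * M * R k\<close> is rounded up so that
    division by \<open>M + 1\<close> leaves \<open>2 * R k\<close>.\<close>
  have contraction: "V (Suc k) \<le> M / (M + 1) * V k + 2 * R k" for k
  proof -
    have "(M + 1) * V (Suc k) \<le> M * (D k + R k) + M * (V k + R k - D k)"
      using bound[of k] mult_left_mono[OF descent[of k], of M] M by (simp add: algebra_simps)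
    also have "\<dots> \<le> M * V k + (M + 1) * (2 * R k)" using R0[of k] by (simp add: algebra_simps)
    finally show ?thesis using M by (simp add: field_simps)
  qed
  have V: "V \<longlonglongrightarrow> 0"
  proof (rule perturbed_contraction_tendsto_0)
    show "(\<lambda>k. 2 * R k) \<longlonglongrightarrow> 0" using tendsto_mult_right_zero[OF R] .
    show "0 \<le> M / (M + 1)" "M / (M + 1) < 1" using M by auto
  qed (use V0 contraction in auto)
  \<comment> \<open>\<open>P\<close> may be singular, so \<open>V\<close> tending to 0 does not by
    itself control the error; the norm is recovered from the strong monotonicity term in
    \<open>D\<close>.\<close>
  have VR: "(\<lambda>k. sqrt (2 / \<mu> * (V k + R k))) \<longlonglongrightarrow> 0"
    using tendsto_real_sqrt[OF tendsto_mult_right_zero[OF tendsto_add_zero[OF V R], of "2 / \<mu>"]]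
    by (simp only: real_sqrt_zero)
  have "norm (x (Suc k) - xs) \<le> sqrt (2 / \<mu> * (V k + R k))" for k
  proof (rule real_le_rsqrt)
    have "\<mu> / 2 * (norm (x (Suc k) - xs))\<^sup>2 \<le> V k + R k"
      using descent[of k] V0[of "Suc k"] mult_nonneg_nonneg[OF less_imp_le[OF \<rho>] p0[of k]]
      unfolding D_def by simp
    then show "(norm (x (Suc k) - xs))\<^sup>2 \<le> 2 / \<mu> * (V k + R k)"
      using \<mu> by (simp add: field_simps)
  qed
  then have "(\<lambda>k. x (Suc k) - xs) \<longlonglongrightarrow> 0"
    by (intro Lim_null_comparison[OF always_eventually VR]) blast
  then have "(\<lambda>k. x (Suc k)) \<longlonglongrightarrow> xs" by (rule LIM_zero_cancel)
  then show ?thesis by (rule LIMSEQ_imp_Suc)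
qed

subsection \<open>Strongly convex functions\<close>

text \<open>The gradient is the Riesz representative of the derivative, obtained as its adjoint at
  1. Uniqueness matters because \<open>grad\<close> is a definite description.\<close>

lemma GDERIV_grad:
  fixes g :: "'a::euclidean_space \<Rightarrow> real"
  assumes "g differentiable at x"
  shows "GDERIV g x :> grad g x"
proof -
  obtain g' where g': "(g has_derivative g') (at x)" using assms by (auto simp: differentiable_def)
  have lin: "linear g'" using has_derivative_linear[OF g'] .
  have "g' = (\<lambda>h. h \<bullet> adjoint g' 1)" by (simp add: adjoint_works[OF lin])
  then have ex: "GDERIV g x :> adjoint g' 1" using g' by (simp add: gderiv_def)
  have "D = adjoint g' 1" if "GDERIV g x :> D" for D
  proof -
    have "(\<lambda>h. h \<bullet> D) = (\<lambda>h. h \<bullet> adjoint g' 1)"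
      using has_derivative_unique that ex unfolding gderiv_def by blast
    then show ?thesis by (metis inner_commute vector_eq_rdot)
  qed
  with ex show ?thesis unfolding grad_def by (rule_tac theI)
qed

lemma GDERIV_sum:
  assumes "\<And>i. i \<in> I \<Longrightarrow> GDERIV (f i) x :> f' i"
  shows "GDERIV (\<lambda>x. \<Sum>i\<in>I. f i x) x :> (\<Sum>i\<in>I. f' i)"
  using assms unfolding gderiv_def inner_sum_right by (intro has_derivative_sum)

lemma GDERIV_norm_squared: "GDERIV (\<lambda>y. (norm (y - a))\<^sup>2) y :> 2 *\<^sub>R (y - a)"
  unfolding gderiv_def power2_norm_eq_inner
  by (auto intro!: derivative_eq_intros simp: inner_commute)

lemma GDERIV_inner_right: "GDERIV (\<lambda>y. c \<bullet> (y - a)) y :> c"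
  unfolding gderiv_def by (auto intro!: derivative_eq_intros simp: inner_commute)

lemma GDERIV_cmult:
  assumes "GDERIV g x :> D" shows "GDERIV (\<lambda>x. c * g x) x :> c *\<^sub>R D"
  using has_derivative_mult_right[OF assms[unfolded gderiv_def], of c] by (simp add: gderiv_def)

lemma GDERIV_minimizer_zero:
  fixes g :: "'a::euclidean_space \<Rightarrow> real"
  assumes "GDERIV g x :> D" and "\<And>y. g x \<le> g y"
  shows "D = 0"
proof -
  have "(\<lambda>h. h \<bullet> D) = (\<lambda>h. 0)"
    using differential_zero_maxmin[of x UNIV g] assms by (auto simp: gderiv_def)
  then show ?thesis by (metis inner_eq_zero_iff)
qed

text \<open>Along the segment from \<open>x\<close> to \<open>y\<close>, \<open>g\<close> minus its
  quadratic minorant has nonnegative derivative. The modulus may be negative, which the Lipschitz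
  upper bound exploits.\<close>

lemma monotone_gradient_lower_bound:
  fixes g :: "'a::euclidean_space \<Rightarrow> real"
  assumes G: "\<And>x. GDERIV g x :> G x"
    and mono: "\<And>x y. m * (norm (x - y))\<^sup>2 \<le> (G x - G y) \<bullet> (x - y)"
  shows "g x + G x \<bullet> (y - x) + m / 2 * (norm (y - x))\<^sup>2 \<le> g y"
proof -
  define v where "v = y - x"
  define \<phi> where "\<phi> t = g (x + t *\<^sub>R v) - t * (G x \<bullet> v) - m / 2 * t\<^sup>2 * (norm v)\<^sup>2" for t
  have deriv: "(\<phi> has_real_derivative ((G (x + t *\<^sub>R v) - G x) \<bullet> v - m * t * (norm v)\<^sup>2)) (at t)" for t
  proof -
    have "((\<lambda>t. g (x + t *\<^sub>R v)) has_derivative (\<lambda>h. (h *\<^sub>R v) \<bullet> G (x + t *\<^sub>R v))) (at t)"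
      by (rule has_derivative_compose[OF _ G[unfolded gderiv_def]])
        (auto intro!: derivative_eq_intros)
    then have "((\<lambda>t. g (x + t *\<^sub>R v)) has_real_derivative G (x + t *\<^sub>R v) \<bullet> v) (at t)"
      by (simp add: has_field_derivative_def inner_commute mult.commute[of _ "inner _ _"])
    then show ?thesis
      unfolding \<phi>_def by (auto intro!: derivative_eq_intros simp: inner_diff_left)
  qed
  have nonneg: "0 \<le> (G (x + t *\<^sub>R v) - G x) \<bullet> v - m * t * (norm v)\<^sup>2" if "0 \<le> t" for t
  proof (cases "t = 0")
    case False
    have "t * (m * t * (norm v)\<^sup>2) \<le> t * ((G (x + t *\<^sub>R v) - G x) \<bullet> v)"
      using mono[of "x + t *\<^sub>R v" x] by (simp add: power_mult_distrib power2_eq_square mult_ac)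
    then show ?thesis using False that by simp
  qed simp
  have "\<phi> 0 \<le> \<phi> 1"
    using deriv nonneg by (intro DERIV_nonneg_imp_nondecreasing[of 0 1 \<phi>]) (simp, blast)
  then show ?thesis by (simp add: \<phi>_def v_def)
qed

text \<open>The Lipschitz condition makes \<open>- G\<close> monotone with modulus
  \<open>- L\<close>, so the lower bound applies to the negated function.\<close>

lemma lipschitz_gradient_upper_bound:
  fixes g :: "'a::euclidean_space \<Rightarrow> real"
  assumes G: "\<And>x. GDERIV g x :> G x" and lip: "L-lipschitz_on UNIV G"
  shows "g y \<le> g x + G x \<bullet> (y - x) + L / 2 * (norm (y - x))\<^sup>2"
proof -
  have "- L * (norm (x - y))\<^sup>2 \<le> (- G x - - G y) \<bullet> (x - y)" for x y
  proof -
    have "(G x - G y) \<bullet> (x - y) \<le> norm (G x - G y) * norm (x - y)" by (rule norm_cauchy_schwarz)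
    also have "\<dots> \<le> L * norm (x - y) * norm (x - y)"
      using lipschitz_onD[OF lip, of x y] by (intro mult_right_mono) (auto simp: dist_norm)
    finally show ?thesis by (simp add: power2_eq_square inner_diff_left)
  qed
  from monotone_gradient_lower_bound[OF GDERIV_minus[OF G] this, of x y]
  show ?thesis by (simp add: inner_minus_left)
qed

lemma strongly_convex_minimizer_exists:
  fixes g :: "'a::euclidean_space \<Rightarrow> real"
  assumes G: "\<And>x. GDERIV g x :> G x" and m: "0 < m"
    and mono: "\<And>x y. m * (norm (x - y))\<^sup>2 \<le> (G x - G y) \<bullet> (x - y)"
  obtains z where "\<And>y. g z \<le> g y"
proof -
  \<comment> \<open>Beyond this radius the quadratic term of the lower bound at 0 outweighs the
    linear one, so \<open>g 0 \<le> g y\<close> there and a minimizer over the ball is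
    global.\<close>
  define B where "B = 2 * norm (G 0) / m"
  have B: "0 \<le> B" using m by (simp add: B_def)
  have "continuous_on UNIV g"
    using G by (auto intro!: continuous_at_imp_continuous_on has_derivative_continuous simp: gderiv_def)
  then have "continuous_on (cball 0 B) g" using continuous_on_subset by blast
  then obtain z where z: "z \<in> cball 0 B" "\<And>y. y \<in> cball 0 B \<Longrightarrow> g z \<le> g y"
    using continuous_attains_inf[OF compact_cball] B by (metis cball_eq_empty not_le)
  have "g z \<le> g y" for y
  proof (cases "y \<in> cball 0 B")
    case False
    then have "norm (G 0) \<le> m / 2 * norm y" using m by (simp add: B_def field_simps)
    then have "norm (G 0) * norm y \<le> m / 2 * (norm y)\<^sup>2"
      by (metis mult_right_mono norm_ge_zero power2_eq_square mult.assoc)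
    moreover have "- (G 0 \<bullet> y) \<le> norm (G 0) * norm y"
      using Cauchy_Schwarz_ineq2[of "G 0" y] by simp
    ultimately have "g 0 \<le> g y"
      using monotone_gradient_lower_bound[OF G mono, of 0 y] by simp
    with z(2)[of 0] B show ?thesis by simp
  qed (use z in simp)
  then show ?thesis using that by blast
qed

text \<open>The difference quotients are uniformly close to the directional derivatives, because the
  Lipschitz constant of the gradients does not depend on \<open>k\<close>.\<close>

lemma convergent_gradients:
  fixes g :: "nat \<Rightarrow> 'a::euclidean_space \<Rightarrow> real"
  assumes G: "\<And>k x. GDERIV (g k) x :> G k x"
    and mono: "\<And>k x y. m * (norm (x - y))\<^sup>2 \<le> (G k x - G k y) \<bullet> (x - y)" and m: "0 \<le> m"
    and lip: "\<And>k. L-lipschitz_on UNIV (G k)"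
    and conv: "\<And>x. convergent (\<lambda>k. g k x)"
  shows "convergent (\<lambda>k. G k x)"
proof -
  have L: "0 \<le> L" using lip by (rule lipschitz_on_nonneg)
  have "Cauchy (\<lambda>k. G k x \<bullet> b)" if b: "b \<in> Basis" for b
  proof (rule metric_CauchyI)
    fix e :: real assume e: "0 < e"
    \<comment> \<open>This width brings the error \<open>L / 2 * t\<close> down to
      \<open>e / 4\<close>. It is the same for all \<open>k\<close>, so \<open>q\<close> converges
      along with the function values; \<open>L + 1\<close> covers \<open>L = 0\<close>.\<close>
    define t where "t = e / (2 * (L + 1))"
    have t: "0 < t" using e L by (simp add: t_def)
    define q where "q k = (g k (x + t *\<^sub>R b) - g k x) / t" for k
    have "0 \<le> q k - G k x \<bullet> b" "q k - G k x \<bullet> b \<le> e / 4" for k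
    proof -
      have "g k x + t * (G k x \<bullet> b) + m / 2 * t\<^sup>2 \<le> g k (x + t *\<^sub>R b)"
        using monotone_gradient_lower_bound[OF G mono, of k x "x + t *\<^sub>R b"] b by simp
      moreover have "0 \<le> m / 2 * t\<^sup>2" using m by simp
      ultimately show "0 \<le> q k - G k x \<bullet> b" using t by (simp add: q_def field_simps)
      have "g k (x + t *\<^sub>R b) \<le> g k x + t * (G k x \<bullet> b) + L / 2 * t\<^sup>2"
        using lipschitz_gradient_upper_bound[OF G lip, of k "x + t *\<^sub>R b" x] b by simp
      then have "q k - G k x \<bullet> b \<le> L / 2 * t"
        using t by (simp add: q_def field_simps power2_eq_square)
      also have "\<dots> \<le> e / 4" using L e by (simp add: t_def field_simps)
      finally show "q k - G k x \<bullet> b \<le> e / 4" .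
    qed note close = this
    have "convergent q"
      unfolding q_def divide_inverse
      by (intro convergent_mult convergent_diff conv convergent_const)
    then have "Cauchy q" by (rule convergent_Cauchy)
    then obtain N where N: "\<And>k l. k \<ge> N \<Longrightarrow> l \<ge> N \<Longrightarrow> dist (q k) (q l) < e / 4"
      using metric_CauchyD[of q "e / 4"] e by (metis zero_less_divide_iff zero_less_numeral)
    have "dist (G k x \<bullet> b) (G l x \<bullet> b) < e" if "k \<ge> N" "l \<ge> N" for k l
      using close[of k] close[of l] N[OF that] e unfolding dist_real_def abs_less_iff by linarith
    then show "\<exists>N. \<forall>k\<ge>N. \<forall>l\<ge>N. dist (G k x \<bullet> b) (G l x \<bullet> b) < e" by blast
  qed
  then have "\<forall>b\<in>Basis. \<exists>l. (\<lambda>k. G k x \<bullet> b) \<longlonglongrightarrow> l"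
    by (meson Cauchy_convergent convergent_def)
  then obtain l where l: "\<And>b. b \<in> Basis \<Longrightarrow> (\<lambda>k. G k x \<bullet> b) \<longlonglongrightarrow> l b" by metis
  have "(\<lambda>k. \<Sum>b\<in>Basis. (G k x \<bullet> b) *\<^sub>R b) \<longlonglongrightarrow> (\<Sum>b\<in>Basis. l b *\<^sub>R b)"
    by (intro tendsto_intros l)
  then show ?thesis unfolding euclidean_representation convergent_def by blast
qed

subsection \<open>Stacked vectors and the graph Laplacian\<close>

lemma block_stack [simp]: "block (stack b) i = b i"
  by (simp add: block_def stack_def vec_eq_iff)

lemma block_add [simp]: "block (x + y) i = block x i + block y i"
  and block_diff [simp]: "block (x - y) i = block x i - block y i"
  and block_scaleR [simp]: "block (c *\<^sub>R x) i = c *\<^sub>R block x i"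
  and block_zero [simp]: "block 0 i = 0"
  by (simp_all add: block_def vec_eq_iff)

lemma block_eqI: "(\<And>i. block x i = block y i) \<Longrightarrow> x = y"
  by (auto simp: block_def vec_eq_iff)

lemma inner_block: "x \<bullet> y = (\<Sum>i\<in>UNIV. block x i \<bullet> block y i)"
  by (simp add: inner_vec_def block_def sum.cartesian_product flip: UNIV_Times_UNIV)

lemma norm_squared_block: "(norm x)\<^sup>2 = (\<Sum>i\<in>UNIV. (norm (block x i))\<^sup>2)"
  unfolding power2_norm_eq_inner by (rule inner_block)

lemma convergent_stack:
  assumes "\<And>i. convergent (\<lambda>k. b k i)"
  shows "convergent (\<lambda>k. stack (b k))"
proof -
  obtain l where l: "\<And>i. (\<lambda>k. b k i) \<longlonglongrightarrow> l i"
    using assms unfolding convergent_def by metis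
  have "(\<lambda>k. stack (b k)) \<longlonglongrightarrow> stack l"
    unfolding stack_def by (intro vec_tendstoI) (simp add: tendsto_vec_nth[OF l])
  then show ?thesis by (auto simp: convergent_def)
qed

lemma block_kronecker_mult:
  "block (kronecker M (mat 1) *v x) i = (\<Sum>j\<in>UNIV. M $ i $ j *\<^sub>R block x j)"
  by (auto simp: block_def kronecker_def mat_def matrix_vector_mult_def vec_eq_iff
      sum.cartesian_product' sum.delta' if_distrib if_distribR cong: if_cong
      simp flip: UNIV_Times_UNIV)

lemma block_kronecker_diag_mult:
  "block (kronecker (diag d) (mat 1) *v x) i = d i *\<^sub>R block x i"
  unfolding block_kronecker_mult diag_def
  by (simp add: if_distrib if_distribR sum.delta cong: if_cong)

text \<open>On a loop the nested conditional in \<open>incidence\<close> would give 1; otherwise a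
  row is the difference of two indicators.\<close>

lemma block_A_matrix_mult:
  assumes "fst (edge e) \<noteq> snd (edge e)"
  shows "block (A_matrix edge *v x) e = block x (fst (edge e)) - block x (snd (edge e))"
proof -
  have "incidence edge $ e $ l *\<^sub>R block x l
      = (if fst (edge e) = l then block x l else 0) - (if snd (edge e) = l then block x l else 0)" for l
    using assms by (auto simp: incidence_def)
  then show ?thesis
    unfolding A_matrix_def block_kronecker_mult by (simp add: sum_subtractf)
qed

text \<open>Adjacent nodes have distinct labels, so \<open>E\<close> is the disjoint union of the
  oriented edges and their reversals.\<close>

lemma sum_oriented_edges:
  fixes \<phi> :: "'w::finite \<times> 'w \<Rightarrow> 'b::ab_group_add"
  assumes "sym E" and lab: "\<And>i j. (i, j) \<in> E \<Longrightarrow> lab i \<noteq> lab j"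
  shows "(\<Sum>(i, j)\<in>oriented_edges lab E. \<phi> (i, j) + \<phi> (j, i)) = (\<Sum>i\<in>UNIV. \<Sum>j\<in>neighbors E i. \<phi> (i, j))"
proof -
  let ?O = "oriented_edges lab E"
  have E: "E = ?O \<union> prod.swap ` ?O"
  proof (intro set_eqI iffI)
    fix p assume p: "p \<in> E"
    obtain i j where ij: "p = (i, j)" by force
    with p assms have "(j, i) \<in> E" "lab i \<noteq> lab j" by (auto dest: symD)
    with p ij show "p \<in> ?O \<union> prod.swap ` ?O"
      by (cases "lab i < lab j") (auto simp: oriented_edges_def image_iff)
  qed (use assms in \<open>auto simp: oriented_edges_def dest: symD\<close>)
  have "(\<Sum>i\<in>UNIV. \<Sum>j\<in>neighbors E i. \<phi> (i, j)) = sum \<phi> (SIGMA i:UNIV. neighbors E i)"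
    by (simp add: sum.Sigma)
  also have "(SIGMA i:UNIV. neighbors E i) = E" by (auto simp: neighbors_def)
  also have "sum \<phi> E = sum \<phi> ?O + sum \<phi> (prod.swap ` ?O)"
    by (subst E, rule sum.union_disjoint) (auto simp: oriented_edges_def)
  also have "sum \<phi> (prod.swap ` ?O) = (\<Sum>(i, j)\<in>?O. \<phi> (j, i))"
    by (subst sum.reindex) (auto simp: prod.swap_def split_def)
  also have "sum \<phi> ?O + \<dots> = (\<Sum>(i, j)\<in>?O. \<phi> (i, j) + \<phi> (j, i))"
    by (simp add: split_def sum.distrib)
  finally show ?thesis by simp
qed

text \<open>Labels that separate adjacent nodes suffice to orient every edge exactly once.\<close>

locale incidence_graph =
  fixes E :: "('w::finite \<times> 'w) set" and lab :: "'w \<Rightarrow> nat" and edge :: "'e::finite \<Rightarrow> 'w \<times> 'w"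
  assumes sym: "sym E"
    and lab: "\<And>i j. (i, j) \<in> E \<Longrightarrow> lab i \<noteq> lab j"
    and edge: "bij_betw edge UNIV (oriented_edges lab E)"
begin

lemma block_A_mult:
  "block (A_matrix edge *v x) e = block x (fst (edge e)) - block x (snd (edge e))"
proof -
  have "edge e \<in> oriented_edges lab E" using edge by (auto simp: bij_betw_def)
  then show ?thesis by (intro block_A_matrix_mult) (auto simp: oriented_edges_def)
qed

lemma A_mult_eq_0_iff:
  "A_matrix edge *v x = 0 \<longleftrightarrow> (\<forall>(i, j)\<in>E. block x i = block x j)"
proof -
  have "A_matrix edge *v x = 0 \<longleftrightarrow> (\<forall>e. block (A_matrix edge *v x) e = 0)"
    using block_eqI[of "A_matrix edge *v x" 0] by auto
  also have "\<dots> \<longleftrightarrow> (\<forall>p\<in>range edge. block x (fst p) = block x (snd p))"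
    by (simp add: block_A_mult)
  also have "range edge = oriented_edges lab E" using edge by (simp add: bij_betw_def)
  also have "(\<forall>p\<in>oriented_edges lab E. block x (fst p) = block x (snd p))
      \<longleftrightarrow> (\<forall>(i, j)\<in>E. block x i = block x j)"
  proof (intro iffI ballI)
    fix p assume *: "\<forall>p\<in>oriented_edges lab E. block x (fst p) = block x (snd p)" and p: "p \<in> E"
    obtain i j where ij: "p = (i, j)" by force
    have "(i, j) \<in> oriented_edges lab E \<or> (j, i) \<in> oriented_edges lab E"
      using p ij symD[OF sym] lab[of i j] by (auto simp: oriented_edges_def)
    with * ij show "case p of (i, j) \<Rightarrow> block x i = block x j" by auto
  qed (auto simp: oriented_edges_def)
  finally show ?thesis .
qed

text \<open>This identifies \<open>A\<^sup>T A\<close> as the graph Laplacian. Tested against an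
  arbitrary \<open>z\<close>, it becomes the inner product of \<open>A s\<close> and
  \<open>A z\<close>, an edge sum that is regrouped by nodes.\<close>

lemma block_laplacian_mult:
  fixes s :: "real ^ ('w \<times> 'n::finite)"
  shows "block ((transpose (A_matrix edge) ** A_matrix edge) *v s) i
    = (\<Sum>j\<in>neighbors E i. block s i - block s j)"
proof -
  let ?A = "A_matrix edge :: real ^ ('w \<times> 'n) ^ ('e \<times> 'n)"
  define lap where "lap = stack (\<lambda>i. \<Sum>j\<in>neighbors E i. block s i - block s j)"
  have "((transpose ?A ** ?A) *v s) \<bullet> z = lap \<bullet> z" for z
  proof -
    \<comment> \<open>The edge term, a product of two block differences, splits into one share for
      each end of the edge.\<close>
    define \<phi> where "\<phi> = (\<lambda>(i, j). (block s i - block s j) \<bullet> block z i)"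
    have "((transpose ?A ** ?A) *v s) \<bullet> z = (?A *v s) \<bullet> (?A *v z)"
      by (simp add: matrix_vector_mul_assoc[symmetric] dot_lmul_matrix)
    also have "\<dots> = (\<Sum>e\<in>UNIV. \<phi> (edge e) + \<phi> (prod.swap (edge e)))"
      by (simp add: inner_block[of "?A *v s"] block_A_mult \<phi>_def split_def inner_diff algebra_simps)
    also have "\<dots> = (\<Sum>p\<in>oriented_edges lab E. \<phi> p + \<phi> (prod.swap p))"
      by (rule sum.reindex_bij_betw[OF edge])
    also have "\<dots> = (\<Sum>(i, j)\<in>oriented_edges lab E. \<phi> (i, j) + \<phi> (j, i))"
      by (simp add: split_def prod.swap_def)
    also have "\<dots> = (\<Sum>i\<in>UNIV. \<Sum>j\<in>neighbors E i. \<phi> (i, j))"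
      by (rule sum_oriented_edges[OF sym lab])
    also have "\<dots> = lap \<bullet> z"
      unfolding inner_block[of lap] by (simp add: lap_def \<phi>_def inner_sum_left)
    finally show ?thesis .
  qed
  then have "(transpose ?A ** ?A) *v s = lap" using vector_eq_rdot by blast
  then show ?thesis by (simp add: lap_def)
qed

end

subsection \<open>The iterates of Algorithm I\<close>

text \<open>The initial multipliers are block differences of \<open>x0\<close>, and each update adds
  block differences of one vector, so all multipliers derive from a single potential.\<close>

lemma snd_algorithm1:
  "snd (algorithm1 E \<gamma> \<rho> h x0 k) =
    (let s = x0 + \<rho> *\<^sub>R (\<Sum>t<k. iterate E \<gamma> \<rho> h x0 (Suc t)) in (\<lambda>i j. block s i - block s j))"
proof (induction k)
  case (Suc k)
  have "snd (algorithm1 E \<gamma> \<rho> h x0 (Suc k)) = (\<lambda>i j. snd (algorithm1 E \<gamma> \<rho> h x0 k) i j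
      + \<rho> *\<^sub>R (block (iterate E \<gamma> \<rho> h x0 (Suc k)) i - block (iterate E \<gamma> \<rho> h x0 (Suc k)) j))"
    by (simp add: iterate_def Let_def split_def)
  then show ?case unfolding Suc by (simp add: Let_def algebra_simps)
qed simp

lemma block_iterate_Suc:
  "block (iterate E \<gamma> \<rho> h x0 (Suc k)) i = arg_min (local_objective E \<gamma> \<rho> (h (Suc k) i)
     (iterate E \<gamma> \<rho> h x0 k) (snd (algorithm1 E \<gamma> \<rho> h x0 k)) i) (\<lambda>_. True)"
  by (simp add: iterate_def Let_def split_def)

text \<open>\<open>arg_min\<close> is a choice, so a minimizer must be shown to exist first. The
  proximal and penalty terms have nonnegative curvature, so the objective inherits the modulus
  \<open>m\<close> of \<open>g\<close>.\<close>

lemma local_objective_stationary: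
  fixes g :: "real ^ 'n::finite \<Rightarrow> real" and E :: "('w::finite \<times> 'w) set"
  assumes G: "\<And>y. GDERIV g y :> G y" and m: "0 < m"
    and mono: "\<And>y z. m * (norm (y - z))\<^sup>2 \<le> (G y - G z) \<bullet> (y - z)"
    and \<gamma>: "0 \<le> \<gamma> i" and \<rho>: "0 \<le> \<rho>"
    and y: "y = arg_min (local_objective E \<gamma> \<rho> g x \<Lambda> i) (\<lambda>_. True)"
  shows "G y + (\<gamma> i * \<rho>) *\<^sub>R (y - block x i) + (\<Sum>j\<in>neighbors E i. \<Lambda> i j + \<rho> *\<^sub>R (y - block x j)) = 0"
proof -
  define F where "F = local_objective E \<gamma> \<rho> g x \<Lambda> i"
  define GF where "GF y = G y + (\<gamma> i * \<rho>) *\<^sub>R (y - block x i)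
    + (\<Sum>j\<in>neighbors E i. \<Lambda> i j + \<rho> *\<^sub>R (y - block x j))" for y
  have quad: "GDERIV (\<lambda>y. c / 2 * (norm (y - a))\<^sup>2) y :> c *\<^sub>R (y - a)" for c y and a :: "real ^ 'n"
    using GDERIV_cmult[OF GDERIV_norm_squared, of "c / 2" a y] by simp
  have F: "GDERIV F y :> GF y" for y
    unfolding F_def local_objective_def GF_def
    by (intro GDERIV_add G quad GDERIV_sum GDERIV_inner_right)
  have "m * (norm (y - z))\<^sup>2 \<le> (GF y - GF z) \<bullet> (y - z)" for y z
  proof -
    have "GF y - GF z = (G y - G z) + (\<gamma> i * \<rho>) *\<^sub>R (y - z) + (\<Sum>j\<in>neighbors E i. \<rho> *\<^sub>R (y - z))"
      unfolding GF_def
      by (simp add: algebra_simps sum.distrib sum_subtractf flip: scaleR_sum_right)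
    then have "(GF y - GF z) \<bullet> (y - z) = (G y - G z) \<bullet> (y - z) + (\<gamma> i * \<rho>) * (norm (y - z))\<^sup>2
        + real (card (neighbors E i)) * \<rho> * (norm (y - z))\<^sup>2"
      by (simp add: inner_add_left power2_norm_eq_inner sum_constant_scaleR del: sum_constant)
    moreover have "0 \<le> (\<gamma> i * \<rho>) * (norm (y - z))\<^sup>2"
      "0 \<le> real (card (neighbors E i)) * \<rho> * (norm (y - z))\<^sup>2" using \<gamma> \<rho> by auto
    ultimately show ?thesis using mono[of y z] by linarith
  qed
  then obtain z where "\<And>y. F z \<le> F y" using strongly_convex_minimizer_exists[OF F m] by blast
  then have "is_arg_min F (\<lambda>_. True) z" by (auto simp: is_arg_min_def not_less)
  then have "is_arg_min F (\<lambda>_. True) y" unfolding y F_def[symmetric] arg_min_def by (rule someI)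
  then have "\<And>z. F y \<le> F z" by (auto simp: is_arg_min_def not_less)
  then have "GF y = 0" by (rule GDERIV_minimizer_zero[OF F])
  then show ?thesis by (simp add: GF_def)
qed

text \<open>The penalty sum is \<open>D\<close> applied to the step plus the Laplacian of the old
  iterate. Replacing \<open>s k\<close> by \<open>s (Suc k)\<close> in the Laplacian term then costs
  \<open>\<rho>\<close> times \<open>Q\<close> applied to the step, whence the \<open>- Q\<close> in
  the proximal matrix.\<close>

lemma (in incidence_graph) iterate_stationary:
  fixes h :: "nat \<Rightarrow> 'w \<Rightarrow> real ^ 'n::finite \<Rightarrow> real" and x0 :: "real ^ ('w \<times> 'n)"
  assumes G: "\<And>k i y. GDERIV (h k i) y :> G k i y" and m: "0 < m"
    and mono: "\<And>k i y z. m * (norm (y - z))\<^sup>2 \<le> (G k i y - G k i z) \<bullet> (y - z)"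
    and \<gamma>: "\<And>i. 0 \<le> \<gamma> i" and \<rho>: "0 \<le> \<rho>"
  defines "x \<equiv> iterate E \<gamma> \<rho> h x0"
  defines "s \<equiv> \<lambda>k. x0 + \<rho> *\<^sub>R (\<Sum>t<k. x (Suc t))"
  defines "Q \<equiv> transpose (A_matrix edge) ** A_matrix edge :: real ^ ('w \<times> 'n) ^ ('w \<times> 'n)"
  shows "stack (\<lambda>i. G (Suc k) i (block (x (Suc k)) i))
    + \<rho> *\<^sub>R ((U_matrix \<gamma> + D_matrix E - Q) *v (x (Suc k) - x k)) + Q *v s (Suc k) = 0"
proof (rule block_eqI)
  fix i
  define y where "y = block (x (Suc k)) i"
  \<comment> \<open>\<open>s k\<close> sums iterates 1 to \<open>k\<close>: it carries the
    multipliers available when iterate \<open>k + 1\<close> is computed.\<close>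
  have "y = arg_min (local_objective E \<gamma> \<rho> (h (Suc k) i) (x k)
      (\<lambda>i j. block (s k) i - block (s k) j) i) (\<lambda>_. True)"
    unfolding y_def x_def s_def block_iterate_Suc snd_algorithm1 by (simp add: Let_def)
  from local_objective_stationary[where \<gamma> = \<gamma>, OF G m mono \<gamma> \<rho> this]
  have "G (Suc k) i y + (\<gamma> i * \<rho>) *\<^sub>R (y - block (x k) i)
      + (\<Sum>j\<in>neighbors E i. block (s k) i - block (s k) j + \<rho> *\<^sub>R (y - block (x k) j)) = 0" .
  moreover have "block (\<rho> *\<^sub>R ((U_matrix \<gamma> + D_matrix E - Q) *v (x (Suc k) - x k)) + Q *v s (Suc k)) i
      = (\<gamma> i * \<rho>) *\<^sub>R (y - block (x k) i)
      + (\<Sum>j\<in>neighbors E i. block (s k) i - block (s k) j + \<rho> *\<^sub>R (y - block (x k) j))"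
  proof -
    have s: "s (Suc k) = s k + \<rho> *\<^sub>R x (Suc k)" by (simp add: s_def algebra_simps)
    have card: "real (card (neighbors E i)) *\<^sub>R v = (\<Sum>j\<in>neighbors E i. v)" for v :: "real ^ 'n"
      by (rule sum_constant_scaleR[symmetric])
    show ?thesis
      unfolding s Q_def U_matrix_def D_matrix_def matrix_vector_mult_add_rdistrib
        matrix_vector_mult_diff_rdistrib block_add block_diff block_scaleR
        block_kronecker_diag_mult block_laplacian_mult card y_def[symmetric]
      by (simp add: algebra_simps scaleR_sum_right sum.distrib sum_subtractf)
  qed
  ultimately show "block (stack (\<lambda>i. G (Suc k) i (block (x (Suc k)) i))
      + \<rho> *\<^sub>R ((U_matrix \<gamma> + D_matrix E - Q) *v (x (Suc k) - x k)) + Q *v s (Suc k)) i = block 0 i"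
    by (simp add: y_def add.assoc)
qed

subsection \<open>The virtual network\<close>

text \<open>Equality propagates along paths of \<open>E\<close> through the \<alpha> nodes, and each
  \<beta> node is tied to its own \<alpha> node.\<close>

lemma virtual_graph_consensus:
  assumes "connected_graph E" and adj: "\<forall>(i, j)\<in>virtual_graph E. b i = b j"
  shows "b i = b j"
proof -
  have Inl: "b (Inl u) = b (Inl v)" for u v
  proof -
    have "(u, v) \<in> E\<^sup>*" using assms(1) by (simp add: connected_graph_def)
    then show ?thesis
    proof (induction rule: rtrancl_induct)
      case (step v w)
      then have "(Inl v, Inl w) \<in> virtual_graph E" by (auto simp: virtual_graph_def)
      with adj step show ?case by auto
    qed simp
  qed
  have Inr: "b (Inl u) = b (Inr u)" for u
    using adj by (auto simp: virtual_graph_def)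
  show ?thesis using Inl Inr by (cases i; cases j) metis+
qed

lemma incidence_graph_virtual:
  fixes E :: "('v::finite \<times> 'v) set"
  assumes "connected_graph E" and num: "bij_betw num UNIV {1..CARD('v)}"
    and edge: "bij_betw edge UNIV (oriented_edges (node_label num) (virtual_graph E))"
  shows "incidence_graph (virtual_graph E) (node_label num) edge"
proof
  have E: "sym E" "irrefl E" using assms(1) by (auto simp: connected_graph_def)
  show "sym (virtual_graph E)"
    using E(1) by (auto simp: virtual_graph_def sym_def)
  \<comment> \<open>Subtraction on naturals truncates: \<open>num i = 0\<close> would give both
    nodes of an agent the label 0.\<close>
  have pos: "1 \<le> num i" for i using num by (auto simp: bij_betw_def)
  have inj: "num i = num j \<longleftrightarrow> i = j" for i j using num by (auto simp: bij_betw_def inj_def)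
  show "node_label num i \<noteq> node_label num j" if "(i, j) \<in> virtual_graph E" for i j
  proof -
    have *: "2 * num u - 1 \<noteq> 2 * num u" for u using pos[of u] by linarith
    have **: "2 * num u - 1 = 2 * num v - 1 \<longleftrightarrow> u = v" for u v
      using pos[of u] pos[of v] inj[of u v] by linarith
    show ?thesis using that E(2) * *[symmetric] **
      by (auto simp: virtual_graph_def irrefl_def)
  qed
qed (rule edge)

section \<open>Uniqueness of the optimum and convergence of the iterates\<close>

lemma sum_UNIV_Plus: "(\<Sum>i\<in>UNIV. \<phi> i) = (\<Sum>i\<in>UNIV. \<phi> (Inl i)) + (\<Sum>i\<in>UNIV. \<phi> (Inr i))"
  for \<phi> :: "'a::finite + 'b::finite \<Rightarrow> 'c::comm_monoid_add"
  by (simp add: sum.Plus flip: UNIV_Plus_UNIV)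

text \<open>With \<open>xs\<close> chosen before \<open>k\<close> and \<open>x0\<close>, the
  equivalence with \<open>x = xs\<close> asserts existence, uniqueness and independence of the
  decomposition at once.\<close>

theorem theorem2:
  fixes E :: "('v::finite \<times> 'v) set"
    and num :: "'v \<Rightarrow> nat"
    and edge :: "'e::finite \<Rightarrow> ('v + 'v) \<times> ('v + 'v)"
    and f :: "'v \<Rightarrow> real ^ 'n::finite \<Rightarrow> real"
    and f\<alpha> f\<beta> :: "nat \<Rightarrow> 'v \<Rightarrow> real ^ 'n \<Rightarrow> real"
    and f\<alpha>_lim :: "'v \<Rightarrow> real ^ 'n \<Rightarrow> real"
    and m Lf :: "'v \<Rightarrow> real"
    and mf L \<rho> :: real
    and \<gamma> :: "'v + 'v \<Rightarrow> real"
  assumes "connected_graph E"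
    and "bij_betw num UNIV {1..CARD('v)}"
    and "bij_betw edge UNIV (oriented_edges (node_label num) (virtual_graph E))"
    and "\<And>k i x. f i x = f\<alpha> k i x + f\<beta> k i x"
    and "\<And>i. 0 < \<gamma> i"
    and "0 < \<rho>"
    and "assumption1 m mf f"
    and "assumption2 Lf f"
    and "assumption3 mf L f\<alpha> f\<beta> f\<alpha>_lim"
    and "pos_semidef (U_matrix \<gamma> + D_matrix (virtual_graph E)
           - transpose (A_matrix edge) ** A_matrix edge
           :: real ^ (('v + 'v) \<times> 'n) ^ (('v + 'v) \<times> 'n))"
  shows "\<exists>xs. (\<forall>k x. optimal_solution edge (node_objective f\<alpha> f\<beta> k) x \<longleftrightarrow> x = xs) \<and>
    (\<forall>x0. (\<lambda>k. iterate (virtual_graph E) \<gamma> \<rho> (node_objective f\<alpha> f\<beta>) x0 k) \<longlonglongrightarrow> xs)"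
proof -
  let ?E = "virtual_graph E"
  define h where "h = node_objective f\<alpha> f\<beta>"
  define G where "G k i = grad (h k i)" for k i
  define F where "F y = (\<Sum>i\<in>UNIV. f i y)" for y
  interpret incidence_graph ?E "node_label num" edge
    by (rule incidence_graph_virtual[OF assms(1,2,3)])
  have mf: "0 < mf" using assms(7) by (simp add: assumption1_def)
  have "h k i differentiable_on UNIV \<and> strong_monotone_grad mf (h k i) \<and> L-lipschitz_on UNIV (G k i)" for k i
    using assms(9) by (cases i) (auto simp: assumption3_def G_def h_def node_objective_def)
  then have G: "\<And>k i y. GDERIV (h k i) y :> G k i y"
    and mono: "\<And>k i y z. mf * (norm (y - z))\<^sup>2 \<le> (G k i y - G k i z) \<bullet> (y - z)"
    and lip: "\<And>k i. L-lipschitz_on UNIV (G k i)"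
    by (auto simp: G_def strong_monotone_grad_def differentiable_on_def intro!: GDERIV_grad)
  have L: "0 \<le> L" using lip by (rule lipschitz_on_nonneg)
  have G_conv: "convergent (\<lambda>k. G k i y)" for i y
  proof (rule convergent_gradients[OF G mono less_imp_le[OF mf] lip])
    fix y
    have \<alpha>: "(\<lambda>k. f\<alpha> k v y) \<longlonglongrightarrow> f\<alpha>_lim v y" for v
      using assms(9) by (simp add: assumption3_def)
    have \<beta>: "f\<beta> k v y = f v y - f\<alpha> k v y" for k v using assms(4)[of v y k] by simp
    have "(\<lambda>k. f\<beta> k v y) \<longlonglongrightarrow> f v y - f\<alpha>_lim v y" for v
      unfolding \<beta> by (intro tendsto_intros \<alpha>)
    with \<alpha> show "convergent (\<lambda>k. h k i y)"
      by (cases i) (auto simp: h_def node_objective_def convergent_def)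
  qed
  \<comment> \<open>The two parts of each agent recombine to \<open>f i\<close>, so the consensus
    objective does not depend on \<open>k\<close>.\<close>
  have F: "(\<Sum>i\<in>UNIV. h k i y) = F y" for k y
    using assms(4)[of _ y k] by (simp add: sum_UNIV_Plus h_def node_objective_def F_def sum.distrib)
  have GF: "GDERIV F y :> (\<Sum>i\<in>UNIV. G k i y)" for k y
    using GDERIV_sum[of UNIV "h k" y "\<lambda>i. G k i y"] G by (simp add: F)
  \<comment> \<open>Every node function contributes \<open>mf\<close> to the modulus of
    \<open>F\<close>; index 0 below is just one way to express the gradient of
    \<open>F\<close>.\<close>
  define \<mu> where "\<mu> = real CARD('v + 'v) * mf"
  have \<mu>: "0 < \<mu>" using mf unfolding \<mu>_def by (intro mult_pos_pos) (simp_all add: card_gt_0_iff)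
  have F_mono: "\<mu> * (norm (y - z))\<^sup>2 \<le> ((\<Sum>i\<in>UNIV. G 0 i y) - (\<Sum>i\<in>UNIV. G 0 i z)) \<bullet> (y - z)" for y z
    using sum_mono[of UNIV "\<lambda>i. mf * (norm (y - z))\<^sup>2" "\<lambda>i. (G 0 i y - G 0 i z) \<bullet> (y - z)"] mono
    unfolding \<mu>_def by (simp only: sum_constant sum_subtractf[symmetric] inner_sum_left mult.assoc)
  obtain ys where ys: "\<And>y. F ys \<le> F y"
    using strongly_convex_minimizer_exists[OF GF \<mu> F_mono] by blast
  \<comment> \<open>The node gradients at \<open>ys\<close> may vary with \<open>k\<close>, but
    their sum is always the gradient of \<open>F\<close>.\<close>
  have G_ys: "(\<Sum>i\<in>UNIV. G k i ys) = 0" for k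
    using GDERIV_minimizer_zero[OF GF ys] .
  have ys_unique: "F ys < F y" if "y \<noteq> ys" for y
  proof -
    have "0 < \<mu> / 2 * (norm (y - ys))\<^sup>2" using that \<mu> by simp
    with monotone_gradient_lower_bound[OF GF F_mono, of ys y] show ?thesis by (simp add: G_ys)
  qed
  define xs :: "real ^ (('v + 'v) \<times> 'n)" where "xs = stack (\<lambda>_. ys)"
  have feasible: "A_matrix edge *v z = 0 \<longleftrightarrow> (\<exists>y. z = stack (\<lambda>_. y))" for z :: "real ^ (('v + 'v) \<times> 'n)"
  proof
    assume "A_matrix edge *v z = 0"
    then have "block z i = block z j" for i j
      using virtual_graph_consensus[OF assms(1)] by (simp add: A_mult_eq_0_iff)
    then show "\<exists>y. z = stack (\<lambda>_. y)" by (metis block_eqI block_stack)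
  qed (auto simp: A_mult_eq_0_iff)
  have optimal: "optimal_solution edge (h k) x \<longleftrightarrow> x = xs" for k x
  proof
    assume *: "optimal_solution edge (h k) x"
    then obtain y where y: "x = stack (\<lambda>_. y)"
      by (auto simp: optimal_solution_def is_arg_min_def feasible)
    have "\<not> F ys < F y"
      using * feasible by (auto simp: optimal_solution_def is_arg_min_def y F)
    then have "y = ys" using ys_unique by blast
    then show "x = xs" by (simp add: y xs_def)
  next
    assume "x = xs"
    then show "optimal_solution edge (h k) x"
      using ys by (auto simp: optimal_solution_def is_arg_min_def feasible xs_def F not_less)
  qed
  have "(\<lambda>k. iterate ?E \<gamma> \<rho> h x0 k) \<longlonglongrightarrow> xs" for x0
  proof -
    define A :: "real ^ (('v + 'v) \<times> 'n) ^ ('e \<times> 'n)" where "A = A_matrix edge"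
    define Q where "Q = transpose A ** A"
    define P where "P = U_matrix \<gamma> + D_matrix ?E - Q"
    define x where "x = iterate ?E \<gamma> \<rho> h x0"
    define s where "s k = x0 + \<rho> *\<^sub>R (\<Sum>t<k. x (Suc t))" for k
    define \<G> where "\<G> k z = stack (\<lambda>i. G k i (block z i))" for k z
    have P: "transpose P = P" "\<And>z. 0 \<le> z \<bullet> (P *v z)"
      using assms(10) unfolding P_def Q_def A_def pos_semidef_def by blast+
    have Q_inner: "(Q *v y) \<bullet> z = (A *v y) \<bullet> (A *v z)" for y z
      by (simp add: Q_def matrix_vector_mul_assoc[symmetric] dot_lmul_matrix)
    \<comment> \<open>The form of \<open>Q\<close> at \<open>z\<close> is the squared norm of
      \<open>A *v z\<close>, so both matrices have the same kernel.\<close>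
    have Q0: "A *v z = 0" if "Q *v z = 0" for z
      using Q_inner[of z z] that by simp
    have "x \<longlonglongrightarrow> xs"
    \<comment> \<open>The modulus is \<open>mf\<close> rather than \<open>\<mu>\<close>: on the
      stacked space monotonicity holds block by block.\<close>
    proof (rule primal_dual_convergence[where P = "\<lambda>z. P *v z" and Q = "\<lambda>z. Q *v z" and G = \<G>
          and \<mu> = mf and L = L and s = s and \<rho> = \<rho>])
      show "y \<bullet> (P *v z) = (P *v y) \<bullet> z" for y z
        using dot_lmul_matrix[of y P z] transpose_matrix_vector[of P y] by (simp add: P(1))
      show "y \<bullet> (Q *v z) = (Q *v y) \<bullet> z" for y z
        using Q_inner[of y z] Q_inner[of z y] by (simp add: inner_commute[of y] inner_commute[of "A *v y"])
      show "0 \<le> z \<bullet> (Q *v z)" for z using Q_inner[of z z] by (simp add: inner_commute[of z])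
      show "mf * (norm (y - z))\<^sup>2 \<le> (\<G> k y - \<G> k z) \<bullet> (y - z)" for k y z
        unfolding norm_squared_block[of "y - z"] inner_block[of "\<G> k y - \<G> k z"] sum_distrib_left
        by (intro sum_mono) (simp add: \<G>_def mono)
      show "norm (\<G> k y - \<G> k z) \<le> L * norm (y - z)" for k y z
      proof (rule power2_le_imp_le)
        have "(norm (\<G> k y - \<G> k z))\<^sup>2 \<le> (\<Sum>i\<in>UNIV. (L * norm (block (y - z) i))\<^sup>2)"
          unfolding norm_squared_block[of "\<G> k y - \<G> k z"]
          using lipschitz_onD[OF lip]
          by (intro sum_mono power_mono) (auto simp: \<G>_def dist_norm)
        also have "\<dots> = (L * norm (y - z))\<^sup>2"
          by (simp add: power_mult_distrib norm_squared_block[of "y - z"] sum_distrib_left)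
        finally show "(norm (\<G> k y - \<G> k z))\<^sup>2 \<le> (L * norm (y - z))\<^sup>2" .
      qed (use L in simp)
      show "Q *v xs = 0"
      proof -
        have "A *v xs = 0" unfolding A_def feasible xs_def by blast
        then show ?thesis by (simp add: Q_def flip: matrix_vector_mul_assoc)
      qed
      \<comment> \<open>Kernel vectors have equal blocks, so they see only the sum of the node
        gradients.\<close>
      show "\<G> k xs \<bullet> z = 0" if z: "Q *v z = 0" for k z
      proof -
        obtain y where "z = stack (\<lambda>_. y)"
          using Q0[OF z] unfolding A_def feasible by blast
        then have "\<G> k xs \<bullet> z = (\<Sum>i\<in>UNIV. G k i ys) \<bullet> y"
          unfolding inner_block[of _ z] inner_sum_left by (simp add: \<G>_def xs_def)
        then show ?thesis by (simp add: G_ys)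
      qed
      show "convergent (\<lambda>k. \<G> k xs)"
        unfolding \<G>_def xs_def by (intro convergent_stack) (simp add: G_conv)
      show "s (Suc k) = s k + \<rho> *\<^sub>R x (Suc k)" for k
        by (simp add: s_def algebra_simps)
      show "\<G> (Suc k) (x (Suc k)) + \<rho> *\<^sub>R (P *v (x (Suc k) - x k)) + Q *v s (Suc k) = 0" for k
        using iterate_stationary[where h = h and \<gamma> = \<gamma> and \<rho> = \<rho> and k = k,
            OF G mf mono less_imp_le[OF assms(5)] less_imp_le[OF assms(6)]]
        unfolding \<G>_def P_def Q_def A_def s_def x_def .
    qed (use P(2) mf assms(6) in auto)
    then show ?thesis by (simp add: x_def)
  qed
  with optimal show ?thesis unfolding h_def by blast
qed

end
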